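(* Let $\mathcal{H}$ be a separable Hilbert space with identity operator $I$, and let $b,c\in P(\mathcal{H})$ be bounded positive operators with $b$ invertible. Then $[b,c]=0$ if and only if $(I,b,c)$ are braidable.
   Context: $P(\mathcal{H})$ is the set of bounded positive operators on $\mathcal{H}$; $[x,y]=xy-yx$. For $x,y\in P(\mathcal{H})$, define $x*y:=(y^{1/2}xy^{1/2})^{1/2}\in P(\mathcal{H})$. Three positive operators $(a,b,c)$ are braidable if the third Reidemeister movement between them is possible, i.e. the identity $x*(y*z)=(x*y)*(x*z)$ holds for every permutation $(x,y,z)$ of $(a,b,c)$. *)

theory Defs
  imports "HOL-Analysis.Analysis" "HOL-Library.Multiset"
begin

section \<open>Complex Hilbert spaces\<close>

text \<open>
  HOL-Analysis only has real inner product spaces. A complex inner product space is one together with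
  a compatible complex scalar multiplication and a sesquilinear form, linear in the first argument,
  whose real part is the real inner product. Hence \<open>cinner x x = (norm x)\<^sup>2\<close>, and norm, topology and
  completeness are those of the real structure.
\<close>

class complex_inner = real_inner +
  fixes scaleC :: "complex \<Rightarrow> 'a \<Rightarrow> 'a"
    and cinner :: "'a \<Rightarrow> 'a \<Rightarrow> complex"
  assumes scaleC_add_right: "scaleC z (x + y) = scaleC z x + scaleC z y"
    and scaleC_add_left: "scaleC (z + w) x = scaleC z x + scaleC w x"
    and scaleC_scaleC: "scaleC z (scaleC w x) = scaleC (z * w) x"
    and scaleC_of_real: "scaleC (complex_of_real r) x = scaleR r x"
    and cinner_commute: "cinner x y = cnj (cinner y x)"
    and cinner_add_left: "cinner (x + x') y = cinner x y + cinner x' y"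
    and cinner_scaleC_left: "cinner (scaleC z x) y = z * cinner x y"
    and inner_eq_Re_cinner: "inner x y = Re (cinner x y)"

class complex_hilbert = complex_inner + complete_space

instantiation complex :: complex_hilbert
begin

definition scaleC_complex :: "complex \<Rightarrow> complex \<Rightarrow> complex"
  where "scaleC_complex z x = z * x"

definition cinner_complex :: "complex \<Rightarrow> complex \<Rightarrow> complex"
  where "cinner_complex x y = x * cnj y"

instance
  by standard
    (simp_all add: scaleC_complex_def cinner_complex_def inner_complex_def algebra_simps
      scaleR_conv_of_real)

end

section \<open>Bounded operators\<close>

text \<open>The type \<open>'a \<Rightarrow>\<^sub>L 'a\<close> consists of the bounded real-linear maps.\<close>

definition bounded_ops :: "('a::complex_hilbert \<Rightarrow>\<^sub>L 'a) set"
  where "bounded_ops = {T. \<forall>z x. blinfun_apply T (scaleC z x) = scaleC z (blinfun_apply T x)}"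

definition positive_ops :: "('a::complex_hilbert \<Rightarrow>\<^sub>L 'a) set"
  where "positive_ops = {T \<in> bounded_ops. \<forall>x. cinner (blinfun_apply T x) x \<in> \<real>\<^sub>\<ge>\<^sub>0}"

definition invertible_op :: "('a::complex_hilbert \<Rightarrow>\<^sub>L 'a) \<Rightarrow> bool"
  where "invertible_op T \<longleftrightarrow>
    (\<exists>S \<in> bounded_ops. T o\<^sub>L S = id_blinfun \<and> S o\<^sub>L T = id_blinfun)"

definition commutator :: "('a::complex_hilbert \<Rightarrow>\<^sub>L 'a) \<Rightarrow> ('a \<Rightarrow>\<^sub>L 'a) \<Rightarrow> ('a \<Rightarrow>\<^sub>L 'a)"
  where "commutator x y = (x o\<^sub>L y) - (y o\<^sub>L x)"

text \<open>The unique positive square root; meaningful for positive arguments only.\<close>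

definition op_sqrt :: "('a::complex_hilbert \<Rightarrow>\<^sub>L 'a) \<Rightarrow> ('a \<Rightarrow>\<^sub>L 'a)"
  where "op_sqrt x = (THE r. r \<in> positive_ops \<and> r o\<^sub>L r = x)"

section \<open>Braidability\<close>

definition op_star :: "('a::complex_hilbert \<Rightarrow>\<^sub>L 'a) \<Rightarrow> ('a \<Rightarrow>\<^sub>L 'a) \<Rightarrow> ('a \<Rightarrow>\<^sub>L 'a)"
    (infixl \<open>\<star>\<close> 70)
  where "x \<star> y = op_sqrt (op_sqrt y o\<^sub>L x o\<^sub>L op_sqrt y)"

definition braidable ::
    "('a::complex_hilbert \<Rightarrow>\<^sub>L 'a) \<Rightarrow> ('a \<Rightarrow>\<^sub>L 'a) \<Rightarrow> ('a \<Rightarrow>\<^sub>L 'a) \<Rightarrow> bool"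
  where "braidable a b c \<longleftrightarrow>
    a \<in> positive_ops \<and> b \<in> positive_ops \<and> c \<in> positive_ops \<and>
    (\<forall>x y z. mset [x, y, z] = mset [a, b, c] \<longrightarrow>
      x \<star> (y \<star> z) = (x \<star> y) \<star> (x \<star> z))"

end

(*
  If b commutes with c, all square roots commute and x * y = x^(1/2) y^(1/2), so both sides of every
  braid identity equal x^(1/2) y^(1/4) z^(1/4).

  Conversely put p = b^(1/4) and q = c^(1/2). The identity for (I, c, b), squared twice and
  divided by p on both sides, reads p q^2 p = q p^2 q, i.e. X = p q is normal. With s = p^(1/2),
  X = s (s q s) s^(-1) is similar to a self-adjoint T. A normal N = s M s^(-1) satisfies
  |N|^m = |N^m| <= K |M|^m for all m = 2^k, hence |N| <= |M|. Applied to X - i t and T - i t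
  this gives |X - i t|^2 <= |T|^2 + t^2 for all real t, which forces X to be self-adjoint:
  p q = q p.

  Square roots are built without functional calculus: for |A| <= 1 the iteration
  Y(n+1) = (A + Y(n)^2) / 2 is dominated in norm by y(n+1) = (1 + y(n)^2) / 2, which increases
  to 1, so it converges in norm and 1 - lim Y is a square root of 1 - A.
*)

theory Submission
  imports Defs
begin

section \<open>Multiplication by \<open>i\<close> as a real-linear operator\<close>

instance complex_hilbert \<subseteq> banach ..

text \<open>The complex structure as a bounded real operator: complex linearity of an operator
  becomes commutation with \<open>J\<close>, so the arguments below run in the real inner product
  space.\<close>

definition J :: "'a::complex_hilbert \<Rightarrow>\<^sub>L 'a"
  where "J = Blinfun (scaleC \<i>)"

lemma inner_scaleC_i_left: "inner (scaleC \<i> x) y = - Im (cinner x y)"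
  by (simp add: inner_eq_Re_cinner cinner_scaleC_left)

lemma cinner_scaleC_right: "cinner x (scaleC z y) = cnj z * cinner x y"
  by (subst (1 2) cinner_commute) (simp add: cinner_scaleC_left)

lemma norm_scaleC_i: "norm (scaleC \<i> x :: 'a::complex_hilbert) = norm x"
  by (simp add: norm_eq_sqrt_inner inner_eq_Re_cinner cinner_scaleC_left cinner_scaleC_right)

lemma bounded_linear_scaleC_i: "bounded_linear (scaleC \<i> :: 'a::complex_hilbert \<Rightarrow> 'a)"
proof (rule bounded_linear_intro[where K = 1])
  fix r and x :: 'a
  have "scaleC \<i> (scaleR r x) = scaleC (\<i> * complex_of_real r) x"
    by (metis scaleC_of_real scaleC_scaleC)
  also have "\<dots> = scaleR r (scaleC \<i> x)"
    by (metis scaleC_of_real scaleC_scaleC mult.commute)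
  finally show "scaleC \<i> (scaleR r x) = scaleR r (scaleC \<i> x)" .
qed (simp_all add: scaleC_add_right norm_scaleC_i)

lemma J_apply: "blinfun_apply J x = scaleC \<i> x"
  by (simp add: J_def bounded_linear_Blinfun_apply bounded_linear_scaleC_i)

lemma J_J [simp]: "blinfun_apply J (blinfun_apply J x) = - x"
proof -
  have "scaleC \<i> (scaleC \<i> x) = scaleC (complex_of_real (-1)) x"
    by (simp add: scaleC_scaleC)
  thus ?thesis
    by (simp only: scaleC_of_real J_apply) simp
qed

lemma inner_J_left: "inner (blinfun_apply J x) y = - inner x (blinfun_apply J y)"
  by (simp add: J_apply inner_eq_Re_cinner cinner_scaleC_left cinner_scaleC_right)

lemma norm_J [simp]: "norm (blinfun_apply J x) = norm x"
  by (simp add: J_apply norm_scaleC_i)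

lemma scaleC_eq_J: "scaleC z x = scaleR (Re z) x + scaleR (Im z) (blinfun_apply J x)"
proof -
  have "scaleC z x = scaleC (complex_of_real (Re z) + complex_of_real (Im z) * \<i>) x"
    by (metis complex_eq mult.commute)
  thus ?thesis
    by (simp only: scaleC_add_left scaleC_scaleC[symmetric] scaleC_of_real J_apply)
qed

lemma blinfun_eq_iff: "S = T \<longleftrightarrow> (\<forall>x. blinfun_apply S x = blinfun_apply T x)"
  by (metis blinfun_eqI)

section \<open>Commuting and adjoint pairs of operators\<close>

definition op_commute :: "('a::real_normed_vector \<Rightarrow>\<^sub>L 'a) \<Rightarrow> ('a \<Rightarrow>\<^sub>L 'a) \<Rightarrow> bool"
  where "op_commute S T \<longleftrightarrow> (\<forall>x. S (T x) = T (S x))"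

text \<open>A relation rather than an operation: every operator below comes with an explicit
  adjoint, so the Riesz representation theorem does not enter.\<close>

definition op_adjoint :: "('a::real_inner \<Rightarrow>\<^sub>L 'a) \<Rightarrow> ('a \<Rightarrow>\<^sub>L 'a) \<Rightarrow> bool"
  where "op_adjoint S T \<longleftrightarrow> (\<forall>x y. inner (S x) y = inner x (T y))"

lemma op_commuteD: "op_commute S T \<Longrightarrow> blinfun_apply S (blinfun_apply T x) = T (S x)"
  by (simp add: op_commute_def)

lemma op_commute_iff: "op_commute S T \<longleftrightarrow> S o\<^sub>L T = T o\<^sub>L S"
  by (auto simp: op_commute_def blinfun_eq_iff)

lemma blinfun_compose_assoc: "(S o\<^sub>L T) o\<^sub>L U = S o\<^sub>L (T o\<^sub>L U)"
  by (simp add: blinfun_eq_iff)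

lemma blinfun_compose_id [simp]: "S o\<^sub>L id_blinfun = S" "id_blinfun o\<^sub>L S = S"
  by (simp_all add: blinfun_eq_iff)

lemma op_commute_sym: "op_commute S T \<Longrightarrow> op_commute T S"
  by (simp add: op_commute_def)

lemma op_commute_self [simp]: "op_commute S S"
  by (simp add: op_commute_def)

lemma op_commute_id [simp]: "op_commute S id_blinfun" "op_commute id_blinfun S"
  by (simp_all add: op_commute_def)

lemma op_commute_compose:
  "op_commute S T \<Longrightarrow> op_commute S U \<Longrightarrow> op_commute S (T o\<^sub>L U)"
  by (simp add: op_commute_def)

lemma op_commute_add:
  "op_commute S T \<Longrightarrow> op_commute S U \<Longrightarrow> op_commute S (T + U)"
  by (simp add: op_commute_def blinfun.bilinear_simps)

lemma op_commute_diff: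
  "op_commute S T \<Longrightarrow> op_commute S U \<Longrightarrow> op_commute S (T - U)"
  by (simp add: op_commute_def blinfun.bilinear_simps)

lemma op_commute_scaleR: "op_commute S T \<Longrightarrow> op_commute S (scaleR r T)"
  by (simp add: op_commute_def blinfun.bilinear_simps)

lemma op_adjointD: "op_adjoint S T \<Longrightarrow> inner (blinfun_apply S x) y = inner x (T y)"
  by (simp add: op_adjoint_def)

lemma op_adjoint_id: "op_adjoint id_blinfun id_blinfun"
  by (simp add: op_adjoint_def)

lemma op_adjoint_add:
  "op_adjoint S T \<Longrightarrow> op_adjoint S' T' \<Longrightarrow> op_adjoint (S + S') (T + T')"
  by (simp add: op_adjoint_def blinfun.bilinear_simps inner_simps)

lemma op_adjoint_diff:
  "op_adjoint S T \<Longrightarrow> op_adjoint S' T' \<Longrightarrow> op_adjoint (S - S') (T - T')"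
  by (simp add: op_adjoint_def blinfun.bilinear_simps inner_simps)

lemma op_adjoint_scaleR: "op_adjoint S T \<Longrightarrow> op_adjoint (scaleR r S) (scaleR r T)"
  by (simp add: op_adjoint_def blinfun.bilinear_simps)

lemma op_adjoint_compose:
  "op_adjoint S T \<Longrightarrow> op_adjoint S' T' \<Longrightarrow> op_adjoint (S o\<^sub>L S') (T' o\<^sub>L T)"
  by (simp add: op_adjoint_def)

section \<open>Positivity in terms of the real inner product\<close>

lemma bounded_ops_iff: "T \<in> bounded_ops \<longleftrightarrow> op_commute T J"
proof
  show "op_commute T J" if "T \<in> bounded_ops"
    using that by (simp add: bounded_ops_def op_commute_def J_apply)
  show "T \<in> bounded_ops" if "op_commute T J"
    using that
    by (simp add: bounded_ops_def op_commute_def scaleC_eq_J blinfun.add_right blinfun.scaleR_right)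
qed

lemma Im_cinner_eq: "Im (cinner x y) = inner x (blinfun_apply J y)"
  using inner_scaleC_i_left[of x y] inner_J_left[of x y] by (simp add: J_apply)

text \<open>The real part of the form gives the inequality. Its imaginary part is
  \<open>inner (T x) (J x)\<close>; polarising the vanishing of that quadratic form and using that
  \<open>T\<close> commutes with \<open>J\<close> yields symmetry.\<close>

lemma positive_ops_iff:
  "T \<in> positive_ops \<longleftrightarrow> op_commute T J \<and> op_adjoint T T \<and> (\<forall>x. 0 \<le> inner (T x) x)"
proof -
  have form: "cinner (T x) x \<in> \<real>\<^sub>\<ge>\<^sub>0 \<longleftrightarrow> 0 \<le> inner (T x) x \<and> inner (T x) (J x) = 0" for x
    by (auto simp: complex_nonneg_Reals_iff inner_eq_Re_cinner Im_cinner_eq)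
  have "op_adjoint T T" if J: "op_commute T J" and q: "\<And>x. inner (T x) (J x) = 0"
    unfolding op_adjoint_def
  proof (intro allI)
    fix x y
    have polar: "inner (T u) (J v) + inner (T v) (J u) = 0" for u v
      using q[of "u + v"] q[of u] q[of v] by (simp add: blinfun.bilinear_simps inner_simps)
    \<comment> \<open>Writing \<open>y\<close> as \<open>- J (J y)\<close> brings the second
      argument into the shape that \<open>polar\<close> handles.\<close>
    have "inner (T x) y = inner (T x) (- J (J y))" by simp
    also have "\<dots> = inner (T (J y)) (J x)"
      using polar[of x "J y"] by simp
    also have "\<dots> = inner (J (T y)) (J x)" using J by (simp add: op_commute_def)
    also have "\<dots> = inner (T y) x" by (simp add: inner_J_left)
    finally show "inner (T x) y = inner x (T y)" by (simp add: inner_commute)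
  qed
  moreover have "inner (T x) (J x) = 0" if J: "op_commute T J" and "op_adjoint T T" for x
  proof -
    have "inner (T x) (J x) = inner x (T (J x))" using that by (simp add: op_adjoint_def)
    also have "\<dots> = - inner (J x) (T x)" using J by (simp add: op_commute_def inner_J_left)
    finally show ?thesis by (simp add: inner_commute)
  qed
  ultimately show ?thesis
    unfolding positive_ops_def mem_Collect_eq bounded_ops_iff form by blast
qed

lemma id_positive: "id_blinfun \<in> positive_ops"
  by (simp add: positive_ops_iff op_adjoint_id)

text \<open>Polarisation expresses \<open>4 * inner (A x) y\<close> through values of the quadratic
  form at \<open>x + y\<close> and \<open>x - y\<close>; the parallelogram law then bounds
  it.\<close>

lemma symmetric_norm_le:
  assumes "op_adjoint A A" and "\<And>x. \<bar>inner (blinfun_apply A x) x\<bar> \<le> (norm x)\<^sup>2"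
  shows "norm A \<le> 1"
proof (rule norm_blinfun_bound)
  fix x
  show "norm (A x) \<le> 1 * norm x"
  proof (cases "A x = 0")
    case False
    hence x: "x \<noteq> 0" by auto
    \<comment> \<open>Rescaling \<open>A x\<close> to the length of \<open>x\<close> makes
      Cauchy-Schwarz an equality for \<open>inner (A x) y\<close>.\<close>
    define y where "y = scaleR (norm x / norm (A x)) (A x)"
    have y: "norm y = norm x" using False by (simp add: y_def)
    have sym: "inner (A y) x = inner (A x) y"
      using assms(1) by (simp add: op_adjoint_def inner_commute)
    have "4 * inner (A x) y = inner (A (x + y)) (x + y) - inner (A (x - y)) (x - y)"
      using sym by (simp add: blinfun.bilinear_simps inner_simps)
    also have "\<dots> \<le> (norm (x + y))\<^sup>2 + (norm (x - y))\<^sup>2"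
      using assms(2)[of "x + y"] assms(2)[of "x - y"] by linarith
    also have "\<dots> = 2 * (norm x)\<^sup>2 + 2 * (norm y)\<^sup>2"
      by (simp add: power2_norm_eq_inner inner_simps)
    finally have "inner (A x) y \<le> (norm x)\<^sup>2" by (simp add: y)
    moreover have "inner (A x) y = norm x * norm (A x)"
      using False by (simp add: y_def dot_square_norm power2_eq_square)
    ultimately show ?thesis using x by (simp add: power2_eq_square)
  qed simp
qed simp

text \<open>Along \<open>y - t T y\<close> the form is a quadratic in \<open>t\<close> without
  constant term and with negative slope at 0 unless \<open>T y = 0\<close>; it would become negative
  for small positive \<open>t\<close>.\<close>

lemma positive_form_zero:
  assumes "T \<in> positive_ops" and "inner (blinfun_apply T y) y = 0"
  shows "T y = 0"
proof (rule ccontr)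
  assume ne: "T y \<noteq> 0"
  define z where "z = T y"
  have sym: "inner (T z) y = inner z z"
    using assms(1) by (simp add: positive_ops_iff op_adjoint_def z_def)
  define k where "k = inner (T z) z"
  have k: "k \<ge> 0" using assms(1) by (simp add: positive_ops_iff k_def)
  have zz: "inner z z > 0" using ne by (simp add: z_def)
  have *: "0 \<le> - 2 * t * inner z z + t * t * k" for t
  proof -
    have "0 \<le> inner (T (y - scaleR t z)) (y - scaleR t z)"
      using assms(1) by (simp add: positive_ops_iff)
    also have "\<dots> = - 2 * t * inner z z + t * t * k"
      using assms(2) sym
      by (simp add: blinfun.bilinear_simps inner_simps k_def z_def[symmetric] algebra_simps)
    finally show ?thesis .
  qed
  \<comment> \<open>Adding 1 to the denominator covers \<open>k = 0\<close> and still keeps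
    \<open>t * k\<close> below \<open>inner z z\<close>.\<close>
  define t where "t = inner z z / (k + 1)"
  have t: "t > 0" and "t * (k + 1) = inner z z"
    using zz k by (simp_all add: t_def)
  hence tk: "t * k + t = inner z z" by (simp add: distrib_left)
  have "0 \<le> t * (t * k - 2 * inner z z)"
    using *[of t] by (simp add: algebra_simps)
  hence "2 * inner z z \<le> t * k" using t by (simp add: zero_le_mult_iff)
  thus False using t tk zz by linarith
qed

section \<open>The square root iteration and its convergence\<close>

primrec sqrt_majorant :: "nat \<Rightarrow> real" where
  "sqrt_majorant 0 = 0"
| "sqrt_majorant (Suc n) = (1 + (sqrt_majorant n)\<^sup>2) / 2"

text \<open>A fixed point \<open>Y\<close> satisfies \<open>2 Y = A + Y^2\<close>, that is,
  \<open>(1 - Y)^2 = 1 - A\<close>. The sequence \<open>sqrt_majorant\<close> is the same iteration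
  for the number 1 in place of \<open>A\<close>.\<close>

primrec sqrt_iter :: "('a::real_normed_vector \<Rightarrow>\<^sub>L 'a) \<Rightarrow> nat \<Rightarrow> ('a \<Rightarrow>\<^sub>L 'a)" where
  "sqrt_iter A 0 = 0"
| "sqrt_iter A (Suc n) = scaleR (1/2) (A + (sqrt_iter A n o\<^sub>L sqrt_iter A n))"

lemma sqrt_majorant_bounds: "0 \<le> sqrt_majorant n \<and> sqrt_majorant n \<le> 1"
  by (induction n) (auto simp: power_le_one)

lemma sqrt_majorant_incseq: "incseq sqrt_majorant"
proof (rule incseq_SucI)
  fix n
  have "0 \<le> (1 - sqrt_majorant n)\<^sup>2" by simp
  thus "sqrt_majorant n \<le> sqrt_majorant (Suc n)" by (simp add: power2_eq_square algebra_simps)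
qed

lemma sqrt_majorant_Cauchy: "Cauchy sqrt_majorant"
proof -
  have "convergent sqrt_majorant"
    using incseq_convergent[OF sqrt_majorant_incseq, of 1] sqrt_majorant_bounds
    by (metis convergentI)
  thus ?thesis by (rule convergent_Cauchy)
qed

text \<open>Each iterate is a polynomial in \<open>A\<close>.\<close>

lemma sqrt_iter_commute: "op_commute S A \<Longrightarrow> op_commute S (sqrt_iter A n)"
  by (induction n)
    (simp_all add: op_commute_scaleR op_commute_add op_commute_compose,
     simp add: op_commute_def)

lemma norm_sqrt_iter_le:
  assumes "norm A \<le> 1"
  shows "norm (sqrt_iter A n) \<le> sqrt_majorant n"
proof (induction n)
  case (Suc n)
  have "norm (sqrt_iter A n o\<^sub>L sqrt_iter A n) \<le> norm (sqrt_iter A n) * norm (sqrt_iter A n)"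
    by (rule norm_blinfun_compose)
  also have "\<dots> \<le> (sqrt_majorant n)\<^sup>2"
    using Suc by (simp add: power2_eq_square mult_mono sqrt_majorant_bounds)
  finally have "norm (A + (sqrt_iter A n o\<^sub>L sqrt_iter A n)) \<le> 1 + (sqrt_majorant n)\<^sup>2"
    using assms by (intro norm_triangle_le add_mono)
  thus ?case by simp
qed simp

text \<open>The iterates commute, so the difference of their squares factors; the scalar sequence
  factors in the same way, and the two factors are compared one by one.\<close>

lemma norm_sqrt_iter_Suc_diff_le:
  assumes "norm A \<le> 1"
  shows "norm (sqrt_iter A (Suc n) - sqrt_iter A n) \<le> sqrt_majorant (Suc n) - sqrt_majorant n"
proof (induction n)
  case 0
  show ?case using assms by simp
next
  case (Suc n)
  let ?Y = "sqrt_iter A (Suc n)" and ?Z = "sqrt_iter A n"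
  let ?y = "sqrt_majorant (Suc n)" and ?z = "sqrt_majorant n"
  have "op_commute ?Y ?Z"
    by (intro sqrt_iter_commute op_commute_sym[OF sqrt_iter_commute]) simp
  hence "sqrt_iter A (Suc (Suc n)) - ?Y = scaleR (1/2) ((?Y - ?Z) o\<^sub>L (?Y + ?Z))"
    unfolding sqrt_iter.simps(2)[of A "Suc n"]
    by (subst (3) sqrt_iter.simps(2), intro blinfun_eqI)
      (simp add: op_commute_def blinfun.bilinear_simps algebra_simps del: sqrt_iter.simps)
  hence "norm (sqrt_iter A (Suc (Suc n)) - ?Y) \<le> norm (?Y - ?Z) * norm (?Y + ?Z) / 2"
    using norm_blinfun_compose[of "?Y - ?Z" "?Y + ?Z"] by simp
  also have "\<dots> \<le> (?y - ?z) * (?y + ?z) / 2"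
    by (intro divide_right_mono mult_mono Suc norm_triangle_le add_mono norm_sqrt_iter_le assms
        diff_ge_0_iff_ge[THEN iffD2] incseq_SucD[OF sqrt_majorant_incseq] norm_ge_zero) simp
  also have "\<dots> = sqrt_majorant (Suc (Suc n)) - ?y"
    by (simp add: power2_eq_square field_simps)
  finally show ?case .
qed

lemma norm_sqrt_iter_diff_le:
  assumes "norm A \<le> 1" and "m \<le> n"
  shows "norm (sqrt_iter A n - sqrt_iter A m) \<le> sqrt_majorant n - sqrt_majorant m"
  using assms(2)
proof (induction n rule: dec_induct)
  case (step n)
  have "norm (sqrt_iter A (Suc n) - sqrt_iter A m)
      \<le> norm (sqrt_iter A (Suc n) - sqrt_iter A n) + norm (sqrt_iter A n - sqrt_iter A m)"
    by (rule norm_diff_triangle_le[OF order_refl order_refl])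
  also have "\<dots> \<le> sqrt_majorant (Suc n) - sqrt_majorant m"
    using norm_sqrt_iter_Suc_diff_le[OF assms(1), of n] step.IH by linarith
  finally show ?case .
qed simp

text \<open>The distances between iterates are dominated by those of a Cauchy sequence of reals, and
  the operator space is complete.\<close>

lemma convergent_sqrt_iter:
  fixes A :: "'a::banach \<Rightarrow>\<^sub>L 'a"
  assumes "norm A \<le> 1"
  shows "convergent (sqrt_iter A)"
proof (rule Cauchy_convergent, rule metric_CauchyI)
  fix e :: real assume "e > 0"
  then obtain M where M: "\<And>m n. m \<ge> M \<Longrightarrow> n \<ge> M \<Longrightarrow> dist (sqrt_majorant m) (sqrt_majorant n) < e"
    using sqrt_majorant_Cauchy metric_CauchyD by blast
  have *: "dist (sqrt_iter A m) (sqrt_iter A n) < e" if "m \<ge> M" "n \<ge> m" for m n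
    using norm_sqrt_iter_diff_le[OF assms that(2)] M[of m n] that
    by (auto simp: dist_norm norm_minus_commute abs_if split: if_splits)
  show "\<exists>M. \<forall>m\<ge>M. \<forall>n\<ge>M. dist (sqrt_iter A m) (sqrt_iter A n) < e"
    using * by (metis dist_commute linear)
qed

section \<open>Existence and uniqueness of positive square roots\<close>

text \<open>The root is \<open>1 - Y\<close> for the limit \<open>Y\<close> of the iteration started
  from \<open>A = 1 - T\<close>. Commutation, symmetry and the bound \<open>norm Y \<le> 1\<close>
  pass to the limit; the bound makes \<open>1 - Y\<close> positive.\<close>

lemma sqrt_exists_contraction:
  fixes T :: "'a::complex_hilbert \<Rightarrow>\<^sub>L 'a"
  assumes T: "T \<in> positive_ops" and n: "norm T \<le> 1"
  shows "\<exists>r\<in>positive_ops. r o\<^sub>L r = T \<and> (\<forall>S. op_commute S T \<longrightarrow> op_commute S r)"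
proof -
  define A where "A = id_blinfun - T"
  have symA: "op_adjoint A A"
    using T by (simp add: A_def positive_ops_iff op_adjoint_diff op_adjoint_id)
  have nA: "norm A \<le> 1"
  proof (rule symmetric_norm_le[OF symA])
    fix x
    have "norm (T x) \<le> norm x"
      using norm_blinfun[of T x] n by (meson mult_left_le_one_le norm_ge_zero order_trans)
    hence "inner (T x) x \<le> (norm x)\<^sup>2"
      using norm_cauchy_schwarz[of "T x" x]
      by (metis power2_eq_square mult_right_mono norm_ge_zero order_trans)
    moreover have "0 \<le> inner (T x) x" using T by (simp add: positive_ops_iff)
    ultimately show "\<bar>inner (A x) x\<bar> \<le> (norm x)\<^sup>2"
      by (simp add: A_def blinfun.bilinear_simps inner_simps dot_square_norm)
  qed
  define Y where "Y = lim (sqrt_iter A)"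
  have lim: "sqrt_iter A \<longlonglongrightarrow> Y"
    using convergent_sqrt_iter[OF nA] by (simp add: Y_def convergent_LIMSEQ_iff)
  have limx: "(\<lambda>n. sqrt_iter A n x) \<longlonglongrightarrow> Y x" for x
    using lim by (intro tendsto_intros)
  have "(\<lambda>n. sqrt_iter A (Suc n)) \<longlonglongrightarrow> scaleR (1/2) (A + (Y o\<^sub>L Y))"
    unfolding sqrt_iter.simps
    by (intro tendsto_intros bounded_bilinear.tendsto[OF bounded_bilinear_blinfun_compose] lim)
  hence fixpt: "Y = scaleR (1/2) (A + (Y o\<^sub>L Y))"
    using LIMSEQ_unique LIMSEQ_Suc[OF lim] by blast
  have commY: "op_commute S Y" if "op_commute S A" for S
    unfolding op_commute_def
  proof
    fix x
    have "(\<lambda>n. sqrt_iter A n (S x)) \<longlonglongrightarrow> S (Y x)"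
      using sqrt_iter_commute[OF that] blinfun.tendsto[OF tendsto_const limx, of S x]
      by (simp add: op_commute_def)
    thus "S (Y x) = Y (S x)" using limx LIMSEQ_unique by blast
  qed
  have symY: "op_adjoint Y Y"
    unfolding op_adjoint_def
  proof (intro allI)
    fix x y
    have sym: "op_adjoint (sqrt_iter A n) (sqrt_iter A n)" for n
      by (induction n) (auto intro: op_adjoint_scaleR op_adjoint_add op_adjoint_compose symA
          simp: op_adjoint_def[of 0])
    have "(\<lambda>n. inner (sqrt_iter A n x) y) \<longlonglongrightarrow> inner (Y x) y"
      by (intro tendsto_intros limx)
    moreover have "(\<lambda>n. inner (sqrt_iter A n x) y) \<longlonglongrightarrow> inner x (Y y)"
      unfolding op_adjointD[OF sym] by (intro tendsto_intros limx)
    ultimately show "inner (Y x) y = inner x (Y y)" using LIMSEQ_unique by blast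
  qed
  have nY: "norm Y \<le> 1"
    using tendsto_norm[OF lim]
    by (rule LIMSEQ_le_const2)
       (meson norm_sqrt_iter_le[OF nA] sqrt_majorant_bounds order_trans)
  define r where "r = id_blinfun - Y"
  have commr: "op_commute S r" if "op_commute S T" for S
    unfolding r_def using that by (intro op_commute_diff commY) (simp_all add: A_def op_commute_diff)
  have "r o\<^sub>L r = T"
  proof (rule blinfun_eqI)
    fix x
    have "scaleR 2 (Y x) = A x + Y (Y x)"
      by (subst fixpt) (simp add: blinfun.bilinear_simps)
    thus "(r o\<^sub>L r) x = T x"
      by (simp add: r_def A_def blinfun.bilinear_simps scaleR_2 algebra_simps)
  qed
  moreover have "r \<in> positive_ops"
    unfolding positive_ops_iff
  proof (intro conjI allI)
    \<comment> \<open>Complex linearity of the root is the commutant property applied to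
      \<open>J\<close>.\<close>
    show "op_commute r J"
      using T by (intro op_commute_sym[OF commr] op_commute_sym[of T J]) (simp add: positive_ops_iff)
    show "op_adjoint r r" by (simp add: r_def op_adjoint_diff op_adjoint_id symY)
    fix x
    have "norm (Y x) \<le> norm x"
      using norm_blinfun[of Y x] nY by (meson mult_left_le_one_le norm_ge_zero order_trans)
    hence "inner (Y x) x \<le> inner x x"
      using norm_cauchy_schwarz[of "Y x" x]
      by (metis power2_eq_square power2_norm_eq_inner mult_right_mono norm_ge_zero order_trans)
    thus "0 \<le> inner (r x) x" by (simp add: r_def blinfun.bilinear_simps inner_simps)
  qed
  ultimately show ?thesis using commr by blast
qed

lemma positive_scaleR:
  "T \<in> positive_ops \<Longrightarrow> 0 \<le> k \<Longrightarrow> scaleR k T \<in> positive_ops"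
  by (simp add: positive_ops_iff op_adjoint_scaleR op_commute_def blinfun.bilinear_simps)

lemma sqrt_exists:
  fixes T :: "'a::complex_hilbert \<Rightarrow>\<^sub>L 'a"
  assumes T: "T \<in> positive_ops"
  shows "\<exists>r\<in>positive_ops. r o\<^sub>L r = T \<and> (\<forall>S. op_commute S T \<longrightarrow> op_commute S r)"
proof -
  \<comment> \<open>Scaling by \<open>1/k\<close> makes \<open>T\<close> a contraction; the summand
    1 keeps \<open>k\<close> positive when \<open>T = 0\<close>.\<close>
  define k where "k = norm T + 1"
  have k: "k > 0" by (simp add: k_def add_nonneg_pos)
  obtain r where r: "r \<in> positive_ops" "r o\<^sub>L r = scaleR (1/k) T"
    "\<And>S. op_commute S (scaleR (1/k) T) \<Longrightarrow> op_commute S r"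
    using sqrt_exists_contraction[of "scaleR (1/k) T"] T k
    by (auto simp: positive_scaleR k_def field_simps)
  have "scaleR (sqrt k) r o\<^sub>L scaleR (sqrt k) r = T"
  proof (rule blinfun_eqI)
    fix x
    have "r (r x) = scaleR (1/k) (T x)"
      using arg_cong[OF r(2), of "\<lambda>f. blinfun_apply f x"] by (simp add: blinfun.bilinear_simps)
    thus "(scaleR (sqrt k) r o\<^sub>L scaleR (sqrt k) r) x = T x"
      using k by (simp add: blinfun.bilinear_simps)
  qed
  moreover have "scaleR (sqrt k) r \<in> positive_ops"
    using r(1) k by (intro positive_scaleR) auto
  ultimately show ?thesis
    using r(3) op_commute_scaleR by blast
qed

text \<open>For \<open>y = (r - s) x\<close> the product \<open>(r + s) y\<close> is
  \<open>(r^2 - s^2) x = 0\<close>. Both nonnegative forms therefore vanish at \<open>y\<close>, so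
  \<open>r y = s y = 0\<close>, and \<open>inner y y = inner x ((r - s) y) = 0\<close>.\<close>

lemma sqrt_unique:
  fixes r s :: "'a::complex_hilbert \<Rightarrow>\<^sub>L 'a"
  assumes r: "r \<in> positive_ops" and s: "s \<in> positive_ops"
    and eq: "r o\<^sub>L r = s o\<^sub>L s" and comm: "op_commute r s"
  shows "r = s"
proof (rule blinfun_eqI)
  fix x
  define y where "y = r x - s x"
  have sq: "r (r x) = s (s x)"
    using arg_cong[OF eq, of "\<lambda>f. blinfun_apply f x"] by simp
  have "r y + s y = 0"
    using sq op_commuteD[OF comm, of x] by (simp add: y_def blinfun.bilinear_simps)
  hence "inner (r y) y + inner (s y) y = 0"
    by (metis inner_add_left inner_zero_left)
  moreover have "inner (r y) y \<ge> 0" "inner (s y) y \<ge> 0"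
    using r s by (simp_all add: positive_ops_iff)
  ultimately have "r y = 0" "s y = 0"
    using positive_form_zero[OF r, of y] positive_form_zero[OF s, of y] by linarith+
  moreover have "inner y y = inner x (r y - s y)"
    using r s by (simp add: y_def positive_ops_iff op_adjoint_def inner_simps blinfun.bilinear_simps)
  ultimately show "r x = s x" by (simp add: y_def)
qed

text \<open>Any positive root \<open>u\<close> of \<open>T\<close> commutes with
  \<open>T = u^2\<close>, hence with the constructed root, which commutes with everything that
  commutes with \<open>T\<close>. Uniqueness among commuting roots thus becomes uniqueness.\<close>

lemma op_sqrt_eqI:
  assumes "r \<in> positive_ops" and "r o\<^sub>L r = T"
  shows "op_sqrt T = r"
  unfolding op_sqrt_def
proof (rule the_equality)
  have sym: "op_adjoint r r" using assms by (simp add: positive_ops_iff)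
  have "T \<in> positive_ops"
    unfolding positive_ops_iff assms(2)[symmetric]
  proof (intro conjI allI op_adjoint_compose sym)
    show "op_commute (r o\<^sub>L r) J"
      using assms(1) by (simp add: positive_ops_iff op_commute_def)
    show "0 \<le> inner ((r o\<^sub>L r) x) x" for x using op_adjointD[OF sym, of "r x" x] by simp
  qed
  then obtain t where t: "t \<in> positive_ops" "t o\<^sub>L t = T" "\<And>S. op_commute S T \<Longrightarrow> op_commute S t"
    using sqrt_exists by blast
  have "u = t" if "u \<in> positive_ops" "u o\<^sub>L u = T" for u
    using sqrt_unique[of u t] t that op_commute_compose[of u u u] by auto
  thus "\<And>u. u \<in> positive_ops \<and> u o\<^sub>L u = T \<Longrightarrow> u = r" using assms by blast
qed (use assms in simp)

lemma
  assumes "T \<in> positive_ops"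
  shows op_sqrt_positive: "op_sqrt T \<in> positive_ops"
    and op_sqrt_square: "op_sqrt T o\<^sub>L op_sqrt T = T"
    and op_sqrt_commute: "op_commute S T \<Longrightarrow> op_commute S (op_sqrt T)"
proof -
  obtain r where r: "r \<in> positive_ops" "r o\<^sub>L r = T" "\<And>S. op_commute S T \<Longrightarrow> op_commute S r"
    using sqrt_exists[OF assms] by blast
  have "op_sqrt T = r" using r(1,2) by (rule op_sqrt_eqI)
  with r show "op_sqrt T \<in> positive_ops" "op_sqrt T o\<^sub>L op_sqrt T = T"
    "op_commute S T \<Longrightarrow> op_commute S (op_sqrt T)"
    by simp_all
qed

section \<open>Products, roots and the star operation for commuting operators\<close>

lemma op_sqrt_commute_left:
  "T \<in> positive_ops \<Longrightarrow> op_commute T S \<Longrightarrow> op_commute (op_sqrt T) S"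
  by (rule op_commute_sym[OF op_sqrt_commute[OF _ op_commute_sym]])

lemma op_sqrt_commute_op_sqrt:
  "S \<in> positive_ops \<Longrightarrow> T \<in> positive_ops \<Longrightarrow> op_commute S T
    \<Longrightarrow> op_commute (op_sqrt S) (op_sqrt T)"
  by (rule op_sqrt_commute[OF _ op_sqrt_commute_left])

lemma positive_conj:
  assumes "x \<in> positive_ops" and "y \<in> positive_ops"
  shows "y o\<^sub>L x o\<^sub>L y \<in> positive_ops"
proof -
  have "0 \<le> inner ((y o\<^sub>L x o\<^sub>L y) v) v" for v
    using assms op_adjointD[of y y "x (y v)" v] by (simp add: positive_ops_iff)
  moreover have "op_commute (y o\<^sub>L x o\<^sub>L y) J" "op_adjoint (y o\<^sub>L x o\<^sub>L y) (y o\<^sub>L x o\<^sub>L y)"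
    using assms by (simp_all add: positive_ops_iff op_commute_def op_adjoint_def)
  ultimately show ?thesis by (simp add: positive_ops_iff)
qed

text \<open>Commutation turns the product into the conjugation of \<open>y\<close> by the root of
  \<open>x\<close>.\<close>

lemma positive_compose:
  assumes x: "x \<in> positive_ops" and y: "y \<in> positive_ops" and "op_commute x y"
  shows "x o\<^sub>L y \<in> positive_ops"
proof -
  have "op_commute (op_sqrt x) y" by (rule op_sqrt_commute_left[OF x assms(3)])
  hence "x o\<^sub>L y = op_sqrt x o\<^sub>L y o\<^sub>L op_sqrt x"
    by (subst op_sqrt_square[OF x, symmetric]) (simp add: op_commute_def blinfun_eq_iff)
  thus ?thesis using positive_conj[OF y op_sqrt_positive[OF x]] by simp
qed

lemma op_sqrt_compose:
  assumes x: "x \<in> positive_ops" and y: "y \<in> positive_ops" and xy: "op_commute x y"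
  shows "op_sqrt (x o\<^sub>L y) = op_sqrt x o\<^sub>L op_sqrt y"
proof (rule op_sqrt_eqI)
  have c: "op_commute (op_sqrt x) (op_sqrt y)"
    by (rule op_sqrt_commute_op_sqrt[OF assms])
  thus "op_sqrt x o\<^sub>L op_sqrt y \<in> positive_ops"
    by (intro positive_compose op_sqrt_positive x y)
  have "(op_sqrt x o\<^sub>L op_sqrt y) o\<^sub>L (op_sqrt x o\<^sub>L op_sqrt y)
      = (op_sqrt x o\<^sub>L op_sqrt x) o\<^sub>L (op_sqrt y o\<^sub>L op_sqrt y)"
    using c by (simp add: op_commute_def blinfun_eq_iff)
  thus "(op_sqrt x o\<^sub>L op_sqrt y) o\<^sub>L (op_sqrt x o\<^sub>L op_sqrt y) = x o\<^sub>L y"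
    by (simp add: op_sqrt_square x y)
qed

lemma op_star_commuting:
  assumes x: "x \<in> positive_ops" and y: "y \<in> positive_ops" and xy: "op_commute x y"
  shows "x \<star> y = op_sqrt x o\<^sub>L op_sqrt y"
proof -
  have "op_commute x (op_sqrt y)" by (rule op_sqrt_commute[OF y xy])
  hence "op_sqrt y o\<^sub>L x o\<^sub>L op_sqrt y = x o\<^sub>L (op_sqrt y o\<^sub>L op_sqrt y)"
    by (simp add: op_commute_def blinfun_eq_iff)
  thus ?thesis by (simp add: op_star_def op_sqrt_square op_sqrt_compose assms)
qed

lemma braid_commuting:
  assumes x: "x \<in> positive_ops" and y: "y \<in> positive_ops" and z: "z \<in> positive_ops"
    and xy: "op_commute x y" and xz: "op_commute x z" and yz: "op_commute y z"
  shows "x \<star> (y \<star> z) = (x \<star> y) \<star> (x \<star> z)"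
proof -
  let ?x = "op_sqrt x" and ?y = "op_sqrt y" and ?z = "op_sqrt z"
  note p = op_sqrt_positive
  have c: "op_commute x ?y" "op_commute x ?z" "op_commute ?x ?y" "op_commute ?x ?z" "op_commute ?y ?z"
    by (intro op_sqrt_commute_op_sqrt op_sqrt_commute assms)+
  note c' = c[THEN op_commute_sym]
  have "x \<star> (y \<star> z) = ?x o\<^sub>L (op_sqrt ?y o\<^sub>L op_sqrt ?z)"
    using assms c by (simp add: op_star_commuting op_sqrt_compose p positive_compose op_commute_compose)
  moreover have "(x \<star> y) \<star> (x \<star> z) = (op_sqrt ?x o\<^sub>L op_sqrt ?y) o\<^sub>L (op_sqrt ?x o\<^sub>L op_sqrt ?z)"
  proof -
    have "op_commute (?x o\<^sub>L ?y) (?x o\<^sub>L ?z)"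
      using c c' by (intro op_commute_compose op_commute_sym[OF op_commute_compose]) simp_all
    thus ?thesis
      using assms c by (simp add: op_star_commuting op_sqrt_compose p positive_compose)
  qed
  \<comment> \<open>The two fourth roots of \<open>x\<close> have to be brought together to merge
    into \<open>op_sqrt x\<close>.\<close>
  moreover have "op_commute (op_sqrt ?y) (op_sqrt ?x)"
    by (intro op_sqrt_commute_op_sqrt p x y c')
  hence "(op_sqrt ?x o\<^sub>L op_sqrt ?y) o\<^sub>L (op_sqrt ?x o\<^sub>L op_sqrt ?z)
      = (op_sqrt ?x o\<^sub>L op_sqrt ?x) o\<^sub>L (op_sqrt ?y o\<^sub>L op_sqrt ?z)"
    by (simp add: op_commute_def blinfun_eq_iff)
  ultimately show ?thesis by (simp add: op_sqrt_square p x)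
qed

section \<open>Norms of normal operators and similarity\<close>

text \<open>Normality gives \<open>norm (N' x) = norm (N x)\<close> for all \<open>x\<close>, so
  \<open>(norm (N x))^2 = inner x (N' (N x))\<close> is at most
  \<open>norm x * norm (N (N x))\<close>.\<close>

lemma norm_square_normal_le:
  assumes adj: "op_adjoint N N'" and comm: "op_commute N N'"
  shows "(norm N)\<^sup>2 \<le> norm (N o\<^sub>L N)"
proof -
  have adj': "inner (N' x) y = inner x (N y)" for x y
    using op_adjointD[OF adj, of y x] by (simp add: inner_commute)
  have eq: "norm (N' x) = norm (N x)" for x
    using op_commuteD[OF comm, of x] by (simp add: norm_eq_sqrt_inner op_adjointD[OF adj] adj')
  have "norm N \<le> sqrt (norm (N o\<^sub>L N))"
  proof (rule norm_blinfun_bound)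
    fix x
    have "(norm (N x))\<^sup>2 = inner x (N' (N x))"
      by (simp add: power2_norm_eq_inner op_adjointD[OF adj])
    also have "\<dots> \<le> norm x * norm (N (N x))"
      using norm_cauchy_schwarz[of x "N' (N x)"] by (simp add: eq)
    also have "\<dots> \<le> norm x * (norm (N o\<^sub>L N) * norm x)"
      using norm_blinfun[of "N o\<^sub>L N" x] by (intro mult_left_mono) auto
    also have "\<dots> = (sqrt (norm (N o\<^sub>L N)) * norm x)\<^sup>2"
      by (simp add: power2_eq_square)
    finally show "norm (N x) \<le> sqrt (norm (N o\<^sub>L N)) * norm x"
      by (rule power2_le_imp_le) simp
  qed simp
  thus ?thesis by (metis norm_ge_zero power_mono real_sqrt_pow2)
qed

lemma norm_normal_similar_le:
  assumes "op_adjoint N N'" and "op_commute N N'"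
    and "N o\<^sub>L s = s o\<^sub>L M" and inv: "s o\<^sub>L s' = id_blinfun"
  shows "norm N \<le> norm M"
proof -
  define K where "K = norm s * norm s'"
  have bound: "norm N ^ (2 ^ k) \<le> K * norm M ^ (2 ^ k)" for k
    using assms(1-3)
  \<comment> \<open>Squaring \<open>N\<close>, \<open>N'\<close> and \<open>M\<close> preserves
    normality and the intertwining by the same \<open>s\<close>, so \<open>K\<close> stays fixed
    while the exponent doubles.\<close>
  proof (induction k arbitrary: N N' M)
    case 0
    have "N = s o\<^sub>L M o\<^sub>L s'"
      using inv 0(3) by (metis blinfun_compose_assoc blinfun_compose_id(1))
    hence "norm N \<le> norm s * norm M * norm s'"
      by (metis norm_blinfun_compose mult_right_mono norm_ge_zero order_trans)
    thus ?case by (simp add: K_def mult_ac)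
  next
    case (Suc k)
    have c: "op_commute (N o\<^sub>L N) (N' o\<^sub>L N')"
      using Suc.prems(2) by (simp add: op_commute_def)
    have e: "(N o\<^sub>L N) o\<^sub>L s = s o\<^sub>L (M o\<^sub>L M)"
      using Suc.prems(3) by (metis blinfun_compose_assoc)
    have "norm N ^ (2 ^ Suc k) = ((norm N)\<^sup>2) ^ (2 ^ k)"
      by (simp add: power_mult[symmetric])
    also have "\<dots> \<le> norm (N o\<^sub>L N) ^ (2 ^ k)"
      by (intro power_mono norm_square_normal_le[OF Suc.prems(1,2)]) simp
    also have "\<dots> \<le> K * norm (M o\<^sub>L M) ^ (2 ^ k)"
      by (rule Suc.IH[OF op_adjoint_compose[OF Suc.prems(1,1)] c e])
    also have "\<dots> \<le> K * ((norm M)\<^sup>2) ^ (2 ^ k)"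
      using norm_blinfun_compose[of M M]
      by (intro mult_left_mono power_mono) (auto simp: K_def power2_eq_square)
    also have "\<dots> = K * norm M ^ (2 ^ Suc k)"
      by (simp add: power_mult[symmetric])
    finally show ?case .
  qed
  show ?thesis
  proof (rule ccontr)
    assume less: "\<not> norm N \<le> norm M"
    show False
    proof (cases "norm M = 0")
      case True
      thus False using bound[of 0] less by simp
    next
      case False
      hence M: "norm M > 0" by simp
      have gt: "norm N / norm M > 1" using less M by simp
      obtain n where n: "K < (norm N / norm M) ^ n" using real_arch_pow[OF gt] by blast
      \<comment> \<open>Since the ratio exceeds 1 and \<open>n \<le> 2 ^ n\<close>, the Archimedean
        exponent may be replaced by a power of two.\<close>
      also have "\<dots> \<le> (norm N / norm M) ^ (2 ^ n)"
        using gt by (intro power_increasing) (auto intro: less_imp_le)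
      finally have "K * norm M ^ (2 ^ n) < norm N ^ (2 ^ n)"
        using M by (simp add: power_divide field_simps)
      thus False using bound[of n] by simp
    qed
  qed
qed

lemma norm_square_diff_scaleR:
  fixes u v :: "'a::real_inner"
  shows "(norm (u - scaleR t v))\<^sup>2 = (norm u)\<^sup>2 - 2 * t * inner u v + t\<^sup>2 * (norm v)\<^sup>2"
  unfolding power2_norm_eq_inner by (simp add: inner_simps inner_commute power2_eq_square)

text \<open>The quadratic form of a symmetric complex-linear operator is real.\<close>

lemma inner_J_zero:
  assumes "op_commute T J" and "op_adjoint T T"
  shows "inner (blinfun_apply T x) (J x) = 0"
proof -
  have "inner (T x) (J x) = - inner (J x) (T x)"
    using assms by (simp add: op_adjointD op_commuteD inner_J_left)
  thus ?thesis by (simp add: inner_commute)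
qed

lemma normal_similar_symmetric:
  fixes X X' T s s' :: "'a::complex_hilbert \<Rightarrow>\<^sub>L 'a"
  assumes adj: "op_adjoint X X'" and norm: "op_commute X X'"
    and XJ: "op_commute X J" "op_commute X' J"
    and T: "op_commute T J" "op_adjoint T T"
    and s: "op_commute s J" "s o\<^sub>L s' = id_blinfun" and sim: "X o\<^sub>L s = s o\<^sub>L T"
  shows "X = X'"
proof -
  \<comment> \<open>The shifted operator is normal with adjoint \<open>X' + \<mu> J\<close>, and it
    stays similar to \<open>T - \<mu> J\<close> because \<open>s\<close> commutes with
    \<open>J\<close>.\<close>
  have shift: "norm (X - scaleR \<mu> J) \<le> sqrt ((norm T)\<^sup>2 + \<mu>\<^sup>2)" for \<mu>
  proof -
    have "op_adjoint (X - scaleR \<mu> J) (X' - scaleR \<mu> (- J))"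
      by (intro op_adjoint_diff op_adjoint_scaleR adj)
        (simp add: op_adjoint_def inner_J_left blinfun.bilinear_simps)
    moreover have "op_commute (X - scaleR \<mu> J) (X' - scaleR \<mu> (- J))"
      using norm XJ by (simp add: op_commute_def blinfun.bilinear_simps algebra_simps)
    moreover have "(X - scaleR \<mu> J) o\<^sub>L s = s o\<^sub>L (T - scaleR \<mu> J)"
      using sim s(1) by (simp add: op_commute_def blinfun_eq_iff blinfun.bilinear_simps)
    ultimately have "norm (X - scaleR \<mu> J) \<le> norm (T - scaleR \<mu> J)"
      using norm_normal_similar_le s(2) by blast
    also have "\<dots> \<le> sqrt ((norm T)\<^sup>2 + \<mu>\<^sup>2)"
    proof (rule norm_blinfun_bound)
      fix x
      \<comment> \<open>The cross term vanishes because the form of \<open>T\<close> is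
        real.\<close>
      have "(norm (T x - scaleR \<mu> (J x)))\<^sup>2 = (norm (T x))\<^sup>2 + \<mu>\<^sup>2 * (norm (J x))\<^sup>2"
        using inner_J_zero[OF T, of x]
        by (simp add: norm_square_diff_scaleR)
      also have "\<dots> \<le> (norm T * norm x)\<^sup>2 + \<mu>\<^sup>2 * (norm x)\<^sup>2"
        by (intro add_mono power_mono norm_blinfun) auto
      also have "\<dots> = (sqrt ((norm T)\<^sup>2 + \<mu>\<^sup>2) * norm x)\<^sup>2"
        by (simp add: power_mult_distrib algebra_simps)
      finally have "norm (T x - scaleR \<mu> (J x)) \<le> sqrt ((norm T)\<^sup>2 + \<mu>\<^sup>2) * norm x"
        by (rule power2_le_imp_le) simp
      thus "norm ((T - scaleR \<mu> J) x) \<le> sqrt ((norm T)\<^sup>2 + \<mu>\<^sup>2) * norm x"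
        by (simp add: blinfun.diff_left blinfun.scaleR_left)
    qed simp
    finally show ?thesis .
  qed
  \<comment> \<open>The quadratic terms in \<open>\<mu>\<close> cancel. What remains is linear in
    \<open>\<mu>\<close> and bounded above, so its coefficient must be 0: the form of
    \<open>X\<close> is real.\<close>
  have lin: "- 2 * \<mu> * inner (X x) (J x) \<le> (norm T)\<^sup>2 * (norm x)\<^sup>2" for \<mu> x
  proof -
    have "norm (X x - scaleR \<mu> (J x)) \<le> sqrt ((norm T)\<^sup>2 + \<mu>\<^sup>2) * norm x"
      using norm_blinfun[of "X - scaleR \<mu> J" x] shift[of \<mu>]
      by (simp add: blinfun.bilinear_simps) (meson mult_right_mono norm_ge_zero order_trans)
    hence "(norm (X x - scaleR \<mu> (J x)))\<^sup>2 \<le> ((norm T)\<^sup>2 + \<mu>\<^sup>2) * (norm x)\<^sup>2"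
      by (metis norm_ge_zero power_mono power_mult_distrib real_sqrt_pow2 add_nonneg_nonneg zero_le_power2)
    moreover have "(norm (X x - scaleR \<mu> (J x)))\<^sup>2
        = (norm (X x))\<^sup>2 - 2 * \<mu> * inner (X x) (J x) + \<mu>\<^sup>2 * (norm (J x))\<^sup>2"
      by (rule norm_square_diff_scaleR)
    ultimately show ?thesis
      using zero_le_power2[of "norm (X x)"] unfolding norm_J distrib_right by linarith
  qed
  have zero: "inner (X x) (J x) = 0" for x
  proof (rule ccontr)
    assume "inner (X x) (J x) \<noteq> 0"
    thus False
      \<comment> \<open>This \<open>\<mu>\<close> makes the left side of \<open>lin\<close> exceed
        the right side by exactly 1.\<close>
      using lin[of "- ((norm T)\<^sup>2 * (norm x)\<^sup>2 + 1) / (2 * inner (X x) (J x))" x]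
      by simp
  qed
  show ?thesis
  proof (rule blinfun_eqI)
    fix x
    have "inner (X x - X' x) (J y) = 0" for y
    proof -
      have "inner (X x) (J y) + inner (X y) (J x) = 0"
        using zero[of "x + y"] zero[of x] zero[of y] by (simp add: blinfun.bilinear_simps inner_simps)
      moreover have "inner (X y) (J x) = - inner (X' x) (J y)"
        unfolding op_adjointD[OF adj] op_commuteD[OF XJ(2)]
        using inner_J_left[of y "X' x"] by (simp add: inner_commute)
      ultimately show ?thesis by (simp add: inner_simps)
    qed
    \<comment> \<open>\<open>J\<close> maps this vector to \<open>X x - X' x\<close>, which is
      therefore orthogonal to itself.\<close>
    from this[of "- J (X x - X' x)"] show "X x = X' x" by (simp add: blinfun.bilinear_simps)
  qed
qed

section \<open>Braidability with the identity\<close>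

lemma op_star_id_left: "w \<in> positive_ops \<Longrightarrow> id_blinfun \<star> w = op_sqrt w"
  by (simp add: op_star_def op_sqrt_square)

theorem mainTheorem4:
  fixes b c :: "'a::complex_hilbert \<Rightarrow>\<^sub>L 'a"
  assumes "separable_space (euclidean :: 'a topology)"
    and "b \<in> positive_ops" and "c \<in> positive_ops"
    and "invertible_op b"
  shows "commutator b c = 0 \<longleftrightarrow> braidable id_blinfun b c"
proof
  assume "commutator b c = 0"
  hence bc: "op_commute b c" by (simp add: commutator_def op_commute_iff)
  have "x \<star> (y \<star> z) = (x \<star> y) \<star> (x \<star> z)" if "mset [x, y, z] = mset [id_blinfun, b, c]" for x y z
  proof (rule braid_commuting)
    \<comment> \<open>Membership of each entry suffices, since the three operators commute pairwise
      and with themselves.\<close>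
    have "set [x, y, z] = set [id_blinfun, b, c]" using that by (metis set_mset_mset)
    hence mem: "x \<in> {id_blinfun, b, c}" "y \<in> {id_blinfun, b, c}" "z \<in> {id_blinfun, b, c}" by auto
    thus "x \<in> positive_ops" "y \<in> positive_ops" "z \<in> positive_ops"
      using assms id_positive by auto
    show "op_commute x y" "op_commute x z" "op_commute y z"
      using mem bc op_commute_sym[OF bc] by auto
  qed
  thus "braidable id_blinfun b c"
    using assms id_positive by (simp add: braidable_def)
next
  assume br: "braidable id_blinfun b c"
  note b = assms(2) and c = assms(3)
  define h where "h = op_sqrt b"
  define p where "p = op_sqrt h"
  define s where "s = op_sqrt p"
  define q where "q = op_sqrt c"
  have pos: "h \<in> positive_ops" "p \<in> positive_ops" "s \<in> positive_ops" "q \<in> positive_ops"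
    using b c by (simp_all add: h_def p_def s_def q_def op_sqrt_positive)
  have sq: "h o\<^sub>L h = b" "p o\<^sub>L p = h" "s o\<^sub>L s = p" "q o\<^sub>L q = c"
    using b c pos by (simp_all add: h_def p_def s_def q_def op_sqrt_square)
  have star: "c \<star> b \<in> positive_ops" "q \<star> h \<in> positive_ops"
    unfolding op_star_def using pos b c by (simp_all add: op_sqrt_positive positive_conj)
  have sqstar: "(c \<star> b) o\<^sub>L (c \<star> b) = h o\<^sub>L c o\<^sub>L h" "(q \<star> h) o\<^sub>L (q \<star> h) = p o\<^sub>L q o\<^sub>L p"
    unfolding op_star_def h_def[symmetric] p_def[symmetric]
    using pos c by (simp_all add: op_sqrt_square positive_conj)
  have "id_blinfun \<star> (c \<star> b) = (id_blinfun \<star> c) \<star> (id_blinfun \<star> b)"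
    using br by (auto simp: braidable_def)
  \<comment> \<open>Starring with the identity on the left takes a root, so two squarings remove all
    roots of products.\<close>
  hence "op_sqrt (c \<star> b) = q \<star> h"
    using b c star by (simp add: op_star_id_left q_def h_def)
  hence "c \<star> b = p o\<^sub>L q o\<^sub>L p"
    using op_sqrt_square[OF star(1)] sqstar(2) by simp
  hence eq: "h o\<^sub>L c o\<^sub>L h = (p o\<^sub>L q o\<^sub>L p) o\<^sub>L (p o\<^sub>L q o\<^sub>L p)"
    using sqstar(1) by simp
  obtain i where i: "b o\<^sub>L i = id_blinfun" "i o\<^sub>L b = id_blinfun"
    using assms(4) by (auto simp: invertible_op_def)
  \<comment> \<open>One-sided inverses of \<open>p\<close> and \<open>s\<close> come from the
    inverse \<open>i\<close> of \<open>b\<close>, since \<open>b = h^2\<close>,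
    \<open>h = p^2\<close> and \<open>p = s^2\<close>.\<close>
  have li: "(i o\<^sub>L h o\<^sub>L p) o\<^sub>L p = id_blinfun" and ri: "p o\<^sub>L (p o\<^sub>L h o\<^sub>L i) = id_blinfun"
    and si: "s o\<^sub>L (s o\<^sub>L p o\<^sub>L h o\<^sub>L i) = id_blinfun"
    using i sq by (metis blinfun_compose_assoc)+
  have normal: "op_commute (p o\<^sub>L q) (q o\<^sub>L p)"
    unfolding op_commute_def
  proof
    fix x
    have inj: "u = v" if "p u = p v" for u v
      using arg_cong[OF that, of "i o\<^sub>L h o\<^sub>L p"] li
      by (metis blinfun_apply_blinfun_compose blinfun_apply_id_blinfun)
    define y where "y = (p o\<^sub>L h o\<^sub>L i) x"
    have py: "p y = x"
      using ri by (metis blinfun_apply_blinfun_compose blinfun_apply_id_blinfun y_def)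
    \<comment> \<open>The outer \<open>p\<close> on the left is cancelled by injectivity; the one on
      the right is absorbed by \<open>x = p y\<close>.\<close>
    have "p (p (q (q (p (p y))))) = p (q (p (p (q (p y)))))"
      using arg_cong[OF eq, of "\<lambda>f. blinfun_apply f y"] by (simp add: sq(2,4)[symmetric])
    hence "p (q (q (p x))) = q (p (p (q x)))" using inj py by metis
    thus "(p o\<^sub>L q) ((q o\<^sub>L p) x) = (q o\<^sub>L p) ((p o\<^sub>L q) x)" by simp
  qed
  have J: "op_commute p J" "op_commute q J" "op_commute s J"
    and sym: "op_adjoint p p" "op_adjoint q q" "op_adjoint s s"
    using pos by (simp_all add: positive_ops_iff)
  have "p o\<^sub>L q = q o\<^sub>L p"
  proof (rule normal_similar_symmetric[OF op_adjoint_compose[OF sym(1,2)] normal])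
    show "op_commute (p o\<^sub>L q) J" "op_commute (q o\<^sub>L p) J"
      using J by (simp_all add: op_commute_def)
    show "op_commute (s o\<^sub>L q o\<^sub>L s) J" using J by (simp add: op_commute_def)
    show "op_adjoint (s o\<^sub>L q o\<^sub>L s) (s o\<^sub>L q o\<^sub>L s)" using sym by (simp add: op_adjoint_def)
    show "(p o\<^sub>L q) o\<^sub>L s = s o\<^sub>L (s o\<^sub>L q o\<^sub>L s)"
      by (simp add: sq(3)[symmetric] blinfun_compose_assoc)
  qed (use J si in auto)
  hence "op_commute p q" by (simp add: op_commute_iff)
  \<comment> \<open>Here \<open>b = p^4\<close> and \<open>c = q^2\<close>.\<close>
  hence "op_commute b c"
    unfolding sq(1,2,4)[symmetric] sq(1)[symmetric] by (simp add: op_commute_def)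
  thus "commutator b c = 0" by (simp add: commutator_def op_commute_iff)
qed

end
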